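(* Let $\tau_1$ and $\tau_2$ be linear topologies on the Riesz space $E$ such that $(E,\tau_2)$ is a Fréchet lattice and $E$ has the $(\tau_2,\tau_1)$-SP. Let $I$ be a $\tau_2$-closed ideal of $E$. Then: (a) if $I$ has the $(\tau_1,\tau_2)$-PSP and $E/I$ has the $(\dot\tau_1,\dot\tau_2)$-PSP, then $E$ has the $(\tau_1,\tau_2)$-PSP; (b) if $I$ has the $(\tau_1,\tau_2)$-SP and $E/I$ has the $(\dot\tau_1,\dot\tau_2)$-SP, then $E$ has the $(\tau_1,\tau_2)$-SP.
   Context: A Fréchet lattice is a Riesz space endowed with a locally convex-solid (hence linear), metrizable and complete topology; a locally convex topology on a Riesz space is locally convex-solid if it is generated by a family of Riesz seminorms (equivalently, if the origin has a basis of neighborhoods formed by convex and solid sets). Given linear topologies $\tau_1,\tau_2$ on a Riesz space $E$: $E$ has the $(\tau_1,\tau_2)$-Schur property, $(\tau_1,\tau_2)$-SP, if $\tau_1$-null sequences in $E$ are $\tau_2$-null; $E$ has the $(\tau_1,\tau_2)$-positive Schur property, $(\tau_1,\tau_2)$-PSP, if $\tau_1$-null sequences in $E$ formed by positive elements (i.e. $x_n\ge 0$) are $\tau_2$-null. Riesz subspaces of $E$ (in particular ideals) carry the relative topologies, still denoted $\tau_1,\tau_2$. For an ideal $I$ of $E$, $E/I$ is the quotient Riesz space, ordered by $\dot x\le\dot y$ if there are $x_1\in\dot x$, $y_1\in\dot y$ with $x_1\le y_1$. For a linear topology $\tau$ on $E$, $\dot\tau$ denotes the quotient topology on $E/I$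 (the finest topology making the quotient map $\pi\colon (E,\tau)\to E/I$ continuous); it is a linear topology. *)

theory Defs
  imports "HOL-Analysis.Analysis" "HOL-Library.Lattice_Algebras"
begin

text \<open>A Riesz space is a type of the following class; the underlying class
  \<^class>\<open>lattice_ab_group_add_abs\<close> fixes the absolute value as \<open>\<bar>x\<bar> = sup x (- x)\<close>.\<close>

class riesz_space = ordered_real_vector + lattice_ab_group_add_abs

definition riesz_ideal :: "'a::riesz_space set \<Rightarrow> bool" where
  "riesz_ideal I \<longleftrightarrow> subspace I \<and> (\<forall>x y. \<bar>x\<bar> \<le> \<bar>y\<bar> \<longrightarrow> y \<in> I \<longrightarrow> x \<in> I)"

text \<open>Linear topologies are not required to be Hausdorff.\<close>

definition linear_topology :: "'a::real_vector topology \<Rightarrow> bool" where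
  "linear_topology T \<longleftrightarrow>
     topspace T = UNIV \<and>
     continuous_map (prod_topology T T) T (\<lambda>(x, y). x + y) \<and>
     continuous_map (prod_topology euclideanreal T) T (\<lambda>(c, x). c *\<^sub>R x)"

definition riesz_seminorm :: "('a::riesz_space \<Rightarrow> real) \<Rightarrow> bool" where
  "riesz_seminorm p \<longleftrightarrow>
     (\<forall>x y. p (x + y) \<le> p x + p y) \<and>
     (\<forall>c x. p (c *\<^sub>R x) = \<bar>c\<bar> * p x) \<and>
     (\<forall>x y. \<bar>x\<bar> \<le> \<bar>y\<bar> \<longrightarrow> p x \<le> p y)"

definition generated_by_seminorms ::
  "'a::real_vector topology \<Rightarrow> ('a \<Rightarrow> real) set \<Rightarrow> bool" where
  "generated_by_seminorms T P \<longleftrightarrow>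
     (\<forall>U. openin T U \<longleftrightarrow>
       (\<forall>x\<in>U. \<exists>F e. finite F \<and> F \<subseteq> P \<and> e > 0 \<and> {y. \<forall>p\<in>F. p (y - x) < e} \<subseteq> U))"

definition locally_convex_solid :: "'a::riesz_space topology \<Rightarrow> bool" where
  "locally_convex_solid T \<longleftrightarrow>
     (\<exists>P. (\<forall>p\<in>P. riesz_seminorm p) \<and> generated_by_seminorms T P)"

text \<open>Completeness refers to the translation-invariant uniformity of a linear topology,
  and is expressed by Cauchy filters.\<close>

definition cauchy_filter_in :: "'a::real_vector topology \<Rightarrow> 'a filter \<Rightarrow> bool" where
  "cauchy_filter_in T F \<longleftrightarrow>
     (\<forall>U. openin T U \<longrightarrow> 0 \<in> U \<longrightarrow> (\<forall>\<^sub>F (x, y) in F \<times>\<^sub>F F. x - y \<in> U))"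

definition complete_topology :: "'a::real_vector topology \<Rightarrow> bool" where
  "complete_topology T \<longleftrightarrow>
     (\<forall>F. F \<noteq> bot \<longrightarrow> cauchy_filter_in T F \<longrightarrow> (\<exists>l. limitin T (\<lambda>x. x) l F))"

definition frechet_lattice :: "'a::riesz_space topology \<Rightarrow> bool" where
  "frechet_lattice T \<longleftrightarrow>
     locally_convex_solid T \<and> metrizable_space T \<and> complete_topology T"

definition coset :: "'a::real_vector set \<Rightarrow> 'a \<Rightarrow> 'a set" where
  "coset I x = {y. y - x \<in> I}"

definition quotient_space :: "'a::real_vector set \<Rightarrow> 'a set set" where
  "quotient_space I = range (coset I)"

definition quotient_le :: "'a::ord set \<Rightarrow> 'a set \<Rightarrow> bool" where
  "quotient_le X Y \<longleftrightarrow> (\<exists>x\<in>X. \<exists>y\<in>Y. x \<le> y)"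

definition quotient_topology :: "'a::real_vector topology \<Rightarrow> 'a set \<Rightarrow> 'a set topology" where
  "quotient_topology T I =
     topology (\<lambda>U. U \<subseteq> coset I ` topspace T \<and> openin T {x \<in> topspace T. coset I x \<in> U})"

lemma openin_quotient_topology:
  "openin (quotient_topology T I) U \<longleftrightarrow>
     U \<subseteq> coset I ` topspace T \<and> openin T {x \<in> topspace T. coset I x \<in> U}"
proof -
  let ?L = "\<lambda>U. U \<subseteq> coset I ` topspace T \<and> openin T {x \<in> topspace T. coset I x \<in> U}"
  have "istopology ?L"
    unfolding istopology_def
  proof (intro conjI allI impI)
    fix S U assume S: "?L S" and U: "?L U"
    show "S \<inter> U \<subseteq> coset I ` topspace T" using S by blast
    have "{x \<in> topspace T. coset I x \<in> S \<inter> U} =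
          {x \<in> topspace T. coset I x \<in> S} \<inter> {x \<in> topspace T. coset I x \<in> U}" by blast
    then show "openin T {x \<in> topspace T. coset I x \<in> S \<inter> U}"
      using S U by (simp add: openin_Int)
  next
    fix K assume K: "\<forall>S\<in>K. ?L S"
    show "\<Union> K \<subseteq> coset I ` topspace T" using K by blast
    have "{x \<in> topspace T. coset I x \<in> \<Union> K} = (\<Union>S\<in>K. {x \<in> topspace T. coset I x \<in> S})"
      by blast
    then show "openin T {x \<in> topspace T. coset I x \<in> \<Union> K}"
      using K by (metis (no_types, lifting) imageE openin_Union)
  qed
  then show ?thesis by (simp add: quotient_topology_def topology_inverse')
qed

lemma topspace_quotient_topology: "topspace (quotient_topology T I) = coset I ` topspace T"
proof (rule subset_antisym)
  show "topspace (quotient_topology T I) \<subseteq> coset I ` topspace T"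
    using openin_topspace openin_quotient_topology by metis
  have "{x \<in> topspace T. coset I x \<in> coset I ` topspace T} = topspace T" by blast
  then show "coset I ` topspace T \<subseteq> topspace (quotient_topology T I)"
    by (intro openin_subset) (simp add: openin_quotient_topology)
qed

lemma quotient_map_coset: "quotient_map T (quotient_topology T I) (coset I)"
  by (auto simp: quotient_map_def topspace_quotient_topology openin_quotient_topology)

text \<open>Both properties are stated for a space with carrier \<open>S\<close> and origin \<open>z\<close> (and order \<open>le\<close>),
  so that they apply alike to a Riesz space, to an ideal and to a quotient.\<close>

definition schur_property :: "'b set \<Rightarrow> 'b \<Rightarrow> 'b topology \<Rightarrow> 'b topology \<Rightarrow> bool" where
  "schur_property S z T1 T2 \<longleftrightarrow>
     (\<forall>x::nat \<Rightarrow> 'b. (\<forall>n. x n \<in> S) \<longrightarrow>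
        limitin T1 x z sequentially \<longrightarrow> limitin T2 x z sequentially)"

definition positive_schur_property ::
  "'b set \<Rightarrow> ('b \<Rightarrow> 'b \<Rightarrow> bool) \<Rightarrow> 'b \<Rightarrow> 'b topology \<Rightarrow> 'b topology \<Rightarrow> bool" where
  "positive_schur_property S le z T1 T2 \<longleftrightarrow>
     (\<forall>x::nat \<Rightarrow> 'b. (\<forall>n. x n \<in> S \<and> le z (x n)) \<longrightarrow>
        limitin T1 x z sequentially \<longrightarrow> limitin T2 x z sequentially)"

end

theory Submission
  imports Defs
begin

text \<open>A \<open>\<tau>\<^sub>1\<close>-null sequence \<open>x\<close> is null modulo \<open>I\<close> for the quotient of \<open>\<tau>\<^sub>1\<close>, hence for the
  quotient of \<open>\<tau>\<^sub>2\<close>. As \<open>\<tau>\<^sub>2\<close> is first countable and the quotient map is open, \<open>x - y\<close> is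
  \<open>\<tau>\<^sub>2\<close>-null for some sequence \<open>y\<close> in \<open>I\<close>. Then \<open>x - y\<close> is also \<open>\<tau>\<^sub>1\<close>-null, so \<open>y\<close> is
  \<open>\<tau>\<^sub>1\<close>-null, hence \<open>\<tau>\<^sub>2\<close>-null, and so is \<open>x\<close>. If \<open>x \<ge> 0\<close>, then \<open>y\<close> may be replaced by its
  positive part, because \<open>\<bar>x - y\<^sup>+\<bar> \<le> \<bar>x - y\<bar>\<close> and \<open>\<tau>\<^sub>2\<close> is locally solid.\<close>

lemma linear_topology_limitin_add:
  assumes "linear_topology T" "limitin T x a F" "limitin T y b F"
  shows "limitin T (\<lambda>n. x n + y n) (a + b) F"
proof -
  have "limitin (prod_topology T T) (\<lambda>n. (x n, y n)) (a, b) F"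
    using assms(2,3) by (simp add: limitin_pairwise o_def)
  then have "limitin T ((\<lambda>(x, y). x + y) \<circ> (\<lambda>n. (x n, y n))) ((\<lambda>(x, y). x + y) (a, b)) F"
    using assms(1) unfolding linear_topology_def by (blast intro: continuous_map_limit)
  then show ?thesis by (simp add: o_def)
qed

lemma linear_topology_continuous_scaleR:
  assumes "linear_topology T"
  shows "continuous_map T T ((*\<^sub>R) c)"
proof -
  have "continuous_map T (prod_topology euclideanreal T) (\<lambda>x. (c, x))"
    by (simp add: continuous_map_pairedI)
  then have "continuous_map T T ((\<lambda>(c, x). c *\<^sub>R x) \<circ> (\<lambda>x. (c, x)))"
    using assms unfolding linear_topology_def by (blast intro: continuous_map_compose)
  then show ?thesis by (simp add: o_def)
qed

lemma linear_topology_limitin_diff: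
  assumes "linear_topology T" "limitin T x a F" "limitin T y b F"
  shows "limitin T (\<lambda>n. x n - y n) (a - b) F"
proof -
  have "limitin T ((*\<^sub>R) (-1) \<circ> y) ((-1) *\<^sub>R b) F"
    using linear_topology_continuous_scaleR[OF assms(1)] assms(3)
    by (rule continuous_map_limit)
  from linear_topology_limitin_add[OF assms(1,2) this] show ?thesis by (simp add: o_def)
qed

lemma linear_topology_continuous_translation:
  assumes "linear_topology T"
  shows "continuous_map T T (\<lambda>x. x + a)"
proof -
  have "continuous_map T (prod_topology T T) (\<lambda>x. (x, a))"
    using assms by (simp add: continuous_map_pairedI linear_topology_def)
  then have "continuous_map T T ((\<lambda>(x, y). x + y) \<circ> (\<lambda>x. (x, a)))"
    using assms unfolding linear_topology_def by (blast intro: continuous_map_compose)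
  then show ?thesis by (simp add: o_def)
qed

lemma coset_eq_iff:
  assumes "subspace I"
  shows "coset I x = coset I y \<longleftrightarrow> x - y \<in> I"
proof
  assume "coset I x = coset I y"
  moreover have "x \<in> coset I x" using assms by (simp add: coset_def subspace_0)
  ultimately show "x - y \<in> I" by (simp add: coset_def)
next
  assume *: "x - y \<in> I"
  have "z - x \<in> I \<longleftrightarrow> z - y \<in> I" for z
  proof
    assume "z - x \<in> I"
    from subspace_add[OF assms this *] show "z - y \<in> I" by simp
  next
    assume "z - y \<in> I"
    from subspace_diff[OF assms this *] show "z - x \<in> I" by simp
  qed
  then show "coset I x = coset I y" by (simp add: coset_def)
qed

text \<open>The coset map is open because the saturation of \<open>U\<close> is the union of the
  translates of \<open>U\<close> by elements of \<open>I\<close>, and translations are continuous.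
  This is what allows small cosets to be represented by small vectors.\<close>

lemma openin_coset_image:
  assumes "linear_topology T" "subspace I" "openin T U"
  shows "openin (quotient_topology T I) (coset I ` U)"
proof -
  have top: "topspace T = UNIV" using assms(1) by (simp add: linear_topology_def)
  have "coset I x \<in> coset I ` U \<longleftrightarrow> (\<exists>i\<in>I. x + i \<in> U)" for x
  proof
    assume "coset I x \<in> coset I ` U"
    then obtain u where "u \<in> U" "coset I u = coset I x" by force
    then show "\<exists>i\<in>I. x + i \<in> U"
      using assms(2) by (intro bexI[of _ "u - x"]) (auto simp: coset_eq_iff)
  next
    assume "\<exists>i\<in>I. x + i \<in> U"
    then obtain i where "i \<in> I" "x + i \<in> U" by blast
    then have "coset I (x + i) = coset I x" using assms(2) by (simp add: coset_eq_iff)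
    with \<open>x + i \<in> U\<close> show "coset I x \<in> coset I ` U" by (metis imageI)
  qed
  then have eq: "{x. coset I x \<in> coset I ` U} = (\<Union>i\<in>I. {x. x + i \<in> U})"
    by blast
  have "openin T {x. x + i \<in> U}" for i
    using openin_continuous_map_preimage[OF linear_topology_continuous_translation[OF assms(1)] assms(3), of i]
    by (simp add: top)
  then have "openin T (\<Union>i\<in>I. {x. x + i \<in> U})" by blast
  then show ?thesis
    by (auto simp: openin_quotient_topology top eq)
qed

text \<open>Each \<open>y n\<close> is chosen so that \<open>x n - y n\<close> is nearly the element
  of the coset of \<open>x n\<close> closest to 0. Openness of the coset map puts elements of every
  given ball about 0 into these cosets eventually, so the nearly minimal distances tend to
  0.\<close>

lemma lift_quotient_null_sequence:
  assumes T: "linear_topology T" "metrizable_space T" and I: "subspace I"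
    and lim: "limitin (quotient_topology T I) (\<lambda>n. coset I (x n)) (coset I 0) sequentially"
  obtains y where "\<And>n. y n \<in> I" "limitin T (\<lambda>n. x n - y n) 0 sequentially"
proof -
  obtain M d where M: "Metric_space M d" and TM: "T = Metric_space.mtopology M d"
    using T(2) by (auto simp: metrizable_space_def)
  interpret Metric_space M d by (fact M)
  have M_UNIV: "a \<in> M" for a using T(1) TM by (simp add: linear_topology_def)
  \<comment> \<open>The distances from 0 to the elements of the coset of \<open>x n\<close>. Only
    distances to 0 are compared, since \<open>d\<close> need not be translation invariant.\<close>
  define D where "D n = (\<lambda>y. d (x n - y) 0) ` I" for n
  have D: "D n \<noteq> {}" "bdd_below (D n)" for n
    unfolding D_def using I subspace_0 by (auto intro!: bdd_belowI[of _ 0])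
  \<comment> \<open>The infimum may not be attained, hence a slack that vanishes as \<open>n\<close>
    grows.\<close>
  have "\<exists>y\<in>I. d (x n - y) 0 < Inf (D n) + 1 / Suc n" for n
    using cInf_lessD[OF D(1), of n "Inf (D n) + 1 / Suc n"] by (auto simp: D_def)
  then obtain y where y: "\<And>n. y n \<in> I" "\<And>n. d (x n - y n) 0 < Inf (D n) + 1 / Suc n"
    by metis
  have "\<forall>\<^sub>F n in sequentially. d (x n - y n) 0 < e" if "e > 0" for e
  proof -
    \<comment> \<open>One half of \<open>e\<close> bounds the infimum, the other half absorbs the
      slack.\<close>
    let ?U = "mball 0 (e / 2)"
    have "openin T ?U" by (simp add: TM)
    from openin_coset_image[OF T(1) I this]
    have "openin (quotient_topology T I) (coset I ` ?U)" .
    moreover have "coset I 0 \<in> coset I ` ?U"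
      using M_UNIV that by (intro imageI) simp
    ultimately have "\<forall>\<^sub>F n in sequentially. coset I (x n) \<in> coset I ` ?U"
      using lim by (simp add: limitin_def)
    moreover have "\<forall>\<^sub>F n in sequentially. 1 / real (Suc n) < e / 2"
      using that by (intro order_tendstoD(2)[OF LIMSEQ_inverse_real_of_nat, unfolded inverse_eq_divide]) simp
    ultimately show ?thesis
    proof eventually_elim
      case (elim n)
      then obtain u where u: "d 0 u < e / 2" "coset I (x n) = coset I u" by auto
      then have "x n - u \<in> I" using I by (simp add: coset_eq_iff)
      \<comment> \<open>The small representative is \<open>u = x n - (x n - u)\<close>, so it
        competes in the infimum.\<close>
      then have "d u 0 \<in> D n" unfolding D_def by (intro image_eqI[of _ _ "x n - u"]) auto
      then have "Inf (D n) \<le> d u 0" using D(2) by (rule cInf_lower)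
      then show ?case using u(1) y(2)[of n] elim(2) commute[of 0 u] by linarith
    qed
  qed
  then have "limitin T (\<lambda>n. x n - y n) 0 sequentially"
    by (simp add: TM limitin_metric M_UNIV)
  with y(1) that show thesis by blast
qed

text \<open>Riesz seminorms are monotone in the absolute value, so every seminorm ball about 0 that
  contains \<open>x n\<close> also contains \<open>y n\<close>.\<close>

lemma locally_convex_solid_limitin_dominated:
  assumes "locally_convex_solid T" and "\<And>n. \<bar>y n\<bar> \<le> \<bar>x n\<bar>" and "limitin T x 0 F"
  shows "limitin T y 0 F"
proof -
  obtain P where P: "\<And>p. p \<in> P \<Longrightarrow> riesz_seminorm p" and gen_P: "generated_by_seminorms T P"
    using assms(1) by (auto simp: locally_convex_solid_def)
  have gen: "openin T U \<longleftrightarrow>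
      (\<forall>x\<in>U. \<exists>F e. finite F \<and> F \<subseteq> P \<and> e > 0 \<and> {y. \<forall>p\<in>F. p (y - x) < e} \<subseteq> U)" for U
    using gen_P unfolding generated_by_seminorms_def by (rule spec)
  have "\<forall>\<^sub>F n in F. y n \<in> U" if U: "openin T U" "0 \<in> U" for U
  proof -
    obtain G e where G: "finite G" "G \<subseteq> P" "e > 0" "{y. \<forall>p\<in>G. p (y - 0) < e} \<subseteq> U"
      using bspec[OF iffD1[OF gen U(1)] U(2)] by blast
    \<comment> \<open>\<open>U\<close> itself need not be solid, so the argument passes to a solid
      ball inside it. Convergence of \<open>x\<close> applies to this ball only once it is known to
      be open.\<close>
    let ?V = "{y. \<forall>p\<in>G. p y < e}"
    have "\<exists>F e'. finite F \<and> F \<subseteq> P \<and> e' > 0 \<and> {y. \<forall>p\<in>F. p (y - x) < e'} \<subseteq> ?V"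
      if "x \<in> ?V" for x
    \<comment> \<open>The radius leaves room for the triangle inequality
      \<open>p y \<le> p (y - x) + p x\<close>; inserting \<open>e\<close> keeps the minimum
      meaningful when \<open>G\<close> is empty.\<close>
    proof (intro exI[of _ G] exI[of _ "Min (insert e ((\<lambda>p. e - p x) ` G))"] conjI)
      show "0 < Min (insert e ((\<lambda>p. e - p x) ` G))" using G that by simp
      show "{y. \<forall>p\<in>G. p (y - x) < Min (insert e ((\<lambda>p. e - p x) ` G))} \<subseteq> ?V"
      proof clarify
        fix y p assume y: "\<forall>p\<in>G. p (y - x) < Min (insert e ((\<lambda>p. e - p x) ` G))" and "p \<in> G"
        then have "p (y - x) < e - p x" using G(1) by auto
        moreover have "p (y - x + x) \<le> p (y - x) + p x"
          using P G(2) \<open>p \<in> G\<close> unfolding riesz_seminorm_def by blast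
        ultimately show "p y < e" by simp
      qed
    qed (use G in auto)
    then have V: "openin T ?V" by (intro iffD2[OF gen] ballI)
    have "p 0 < e" if "p \<in> G" for p
    proof -
      have "p (0 *\<^sub>R 0) = \<bar>0\<bar> * p 0"
        using P G(2) that unfolding riesz_seminorm_def by blast
      then show ?thesis using G(3) by simp
    qed
    then have "0 \<in> ?V" by blast
    with V have "\<forall>\<^sub>F n in F. x n \<in> ?V"
      using assms(3) unfolding limitin_def by blast
    then show ?thesis
    proof eventually_elim
      case (elim n)
      have "p (y n) \<le> p (x n)" if "p \<in> G" for p
        using P[of p] G(2) that assms(2)[of n] unfolding riesz_seminorm_def by blast
      then have "\<forall>p\<in>G. p (y n) < e" using elim by force
      then show ?case using G(4) by auto
    qed
  qed
  with assms(3) show ?thesis by (simp add: limitin_def)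
qed

text \<open>Since \<open>x\<close> is its own positive part, this is an instance of the positive
  part being a contraction. For the less direct bound, \<open>x + \<bar>x - y\<bar>\<close> lies
  above both \<open>y\<close> and 0, hence above their supremum \<open>pprt y\<close>.\<close>

lemma abs_diff_pprt_le:
  fixes x y :: "'a::lattice_ab_group_add_abs"
  assumes "0 \<le> x"
  shows "\<bar>x - pprt y\<bar> \<le> \<bar>x - y\<bar>"
proof (rule abs_leI)
  have "x \<le> pprt y + \<bar>x - y\<bar>"
    using abs_ge_self[of "x - y"] add_mono[of y "pprt y" "x - y" "\<bar>x - y\<bar>"]
    by (simp add: pprt_def)
  then show "x - pprt y \<le> \<bar>x - y\<bar>" by (simp add: algebra_simps)
  have "y \<le> x + \<bar>x - y\<bar>"
    using abs_ge_minus_self[of "x - y"] by (simp add: algebra_simps)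
  moreover have "0 \<le> x + \<bar>x - y\<bar>" using assms by simp
  ultimately have "pprt y \<le> x + \<bar>x - y\<bar>" by (simp add: pprt_def)
  then show "- (x - pprt y) \<le> \<bar>x - y\<bar>" by (simp add: algebra_simps)
qed

lemma riesz_ideal_pprt:
  fixes y :: "'a::riesz_space"
  assumes "riesz_ideal I" "y \<in> I"
  shows "pprt y \<in> I"
proof -
  have "\<bar>pprt y\<bar> \<le> \<bar>y\<bar>" by (simp add: abs_ge_self pprt_def)
  with assms show ?thesis unfolding riesz_ideal_def by blast
qed

theorem theorem2p1:
  fixes T1 T2 :: "'a::riesz_space topology" and I :: "'a set"
  assumes "linear_topology T1" and "linear_topology T2"
    and "frechet_lattice T2"
    and "schur_property UNIV 0 T2 T1"
    and "riesz_ideal I" and "closedin T2 I"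
  shows
    "(positive_schur_property I (\<le>) 0 (subtopology T1 I) (subtopology T2 I) \<and>
      positive_schur_property (quotient_space I) quotient_le (coset I 0)
        (quotient_topology T1 I) (quotient_topology T2 I) \<longrightarrow>
      positive_schur_property UNIV (\<le>) 0 T1 T2) \<and>
     (schur_property I 0 (subtopology T1 I) (subtopology T2 I) \<and>
      schur_property (quotient_space I) (coset I 0)
        (quotient_topology T1 I) (quotient_topology T2 I) \<longrightarrow>
      schur_property UNIV 0 T1 T2)"
proof (intro conjI impI)
  have I: "subspace I" using assms(5) by (simp add: riesz_ideal_def)
  have lcs: "locally_convex_solid T2" and met: "metrizable_space T2"
    using assms(3) by (simp_all add: frechet_lattice_def)
  have quot: "limitin (quotient_topology T1 I) (\<lambda>n. coset I (x n)) (coset I 0) sequentially"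
    if "limitin T1 x 0 sequentially" for x
    using continuous_map_limit[OF quotient_imp_continuous_map[OF quotient_map_coset] that]
    by (simp add: o_def)
  \<comment> \<open>The \<open>(T2, T1)\<close>-Schur property enters here: a \<open>T2\<close>-null
    error is also \<open>T1\<close>-null, so the lifted sequence inherits \<open>T1\<close>-nullity
    from \<open>x\<close> through \<open>y = x - (x - y)\<close>.\<close>
  have null1: "limitin T1 y 0 sequentially"
    if "limitin T1 x 0 sequentially" "limitin T2 (\<lambda>n. x n - y n) 0 sequentially" for x y
  proof -
    have "limitin T1 (\<lambda>n. x n - y n) 0 sequentially"
      using assms(4) that(2) by (simp add: schur_property_def)
    from linear_topology_limitin_diff[OF assms(1) that(1) this] show ?thesis by simp
  qed
  have null2: "limitin T2 x 0 sequentially"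
    if "limitin T2 y 0 sequentially" "limitin T2 (\<lambda>n. x n - y n) 0 sequentially" for x y
    using linear_topology_limitin_add[OF assms(2) that] by simp
  {
    assume "positive_schur_property I (\<le>) 0 (subtopology T1 I) (subtopology T2 I) \<and>
      positive_schur_property (quotient_space I) quotient_le (coset I 0)
        (quotient_topology T1 I) (quotient_topology T2 I)"
    then have pI: "positive_schur_property I (\<le>) 0 (subtopology T1 I) (subtopology T2 I)"
      and pQ: "positive_schur_property (quotient_space I) quotient_le (coset I 0)
        (quotient_topology T1 I) (quotient_topology T2 I)" by blast+
    show "positive_schur_property UNIV (\<le>) 0 T1 T2"
      unfolding positive_schur_property_def
    proof (intro allI impI)
      fix x :: "nat \<Rightarrow> 'a"
      assume pos: "\<forall>n. x n \<in> UNIV \<and> 0 \<le> x n" and x: "limitin T1 x 0 sequentially"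
      \<comment> \<open>The representatives 0 and \<open>x n\<close> witness the order between the
        cosets.\<close>
      have "quotient_le (coset I 0) (coset I (x n))" for n
        unfolding quotient_le_def using pos I
        by (intro bexI[of _ 0] bexI[of _ "x n"]) (auto simp: coset_def subspace_0)
      moreover have "coset I (x n) \<in> quotient_space I" for n
        by (simp add: quotient_space_def)
      ultimately have
        "limitin (quotient_topology T2 I) (\<lambda>n. coset I (x n)) (coset I 0) sequentially"
        using pQ quot[OF x] by (simp add: positive_schur_property_def)
      then obtain y where yI: "\<And>n. y n \<in> I"
        and xy: "limitin T2 (\<lambda>n. x n - y n) 0 sequentially"
        using lift_quotient_null_sequence[OF assms(2) met I] by metis
      \<comment> \<open>The lift gives no control over the sign of \<open>y n\<close>, whereas the
        property of \<open>I\<close> concerns positive sequences; solidity keeps \<open>z n\<close>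
        inside \<open>I\<close>.\<close>
      define z where "z n = pprt (y n)" for n
      have zI: "z n \<in> I" and zpos: "0 \<le> z n" for n
        using riesz_ideal_pprt[OF assms(5) yI] by (simp_all add: z_def)
      have xz: "limitin T2 (\<lambda>n. x n - z n) 0 sequentially"
        by (rule locally_convex_solid_limitin_dominated[OF lcs _ xy])
          (simp add: z_def abs_diff_pprt_le pos)
      have "limitin (subtopology T1 I) z 0 sequentially"
        using null1[OF x xz] zI I by (simp add: limitin_subtopology subspace_0)
      then have "limitin (subtopology T2 I) z 0 sequentially"
        using pI zI zpos by (simp add: positive_schur_property_def)
      then have "limitin T2 z 0 sequentially" by (simp add: limitin_subtopology)
      then show "limitin T2 x 0 sequentially" using xz by (rule null2)
    qed
  next
    assume "schur_property I 0 (subtopology T1 I) (subtopology T2 I) \<and>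
      schur_property (quotient_space I) (coset I 0)
        (quotient_topology T1 I) (quotient_topology T2 I)"
    then have pI: "schur_property I 0 (subtopology T1 I) (subtopology T2 I)"
      and pQ: "schur_property (quotient_space I) (coset I 0)
        (quotient_topology T1 I) (quotient_topology T2 I)" by blast+
    show "schur_property UNIV 0 T1 T2"
      unfolding schur_property_def
    proof (intro allI impI)
      fix x :: "nat \<Rightarrow> 'a"
      assume x: "limitin T1 x 0 sequentially"
      have "limitin (quotient_topology T2 I) (\<lambda>n. coset I (x n)) (coset I 0) sequentially"
        using pQ quot[OF x] by (simp add: schur_property_def quotient_space_def)
      then obtain y where yI: "\<And>n. y n \<in> I"
        and xy: "limitin T2 (\<lambda>n. x n - y n) 0 sequentially"
        using lift_quotient_null_sequence[OF assms(2) met I] by metis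
      \<comment> \<open>The Schur property of \<open>I\<close> admits sequences of any sign, so it
        is applied to the lift \<open>y\<close> itself.\<close>
      have "limitin (subtopology T1 I) y 0 sequentially"
        using null1[OF x xy] yI I by (simp add: limitin_subtopology subspace_0)
      then have "limitin (subtopology T2 I) y 0 sequentially"
        using pI yI by (simp add: schur_property_def)
      then have "limitin T2 y 0 sequentially" by (simp add: limitin_subtopology)
      then show "limitin T2 x 0 sequentially" using xy by (rule null2)
    qed
  }
qed

end
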